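(* Let $\omega_0>0$, let $\omega^2:\mathbb{R}\to\mathbb{R}$ be continuous with $\omega^2(t)=\omega_0^2$ for $t\notin[t_i,t_f]$, and let $\alpha,\beta$ be the Bogoliubov coefficients of $\ddot\phi+\omega^2(t)\phi=0$ as defined in the context. Let $\Omega:[t_i,t_f]\to\mathbb{R}$ be any continuously differentiable, nowhere zero real function with $\Omega(t_i)=\omega_0=\Omega(t_f)$. Then $$|\alpha|^2\le\cosh^2\left\{\frac12\int_{t_i}^{t_f}\frac{1}{|\Omega|}\sqrt{\dot\Omega^2+\left[\Omega^2-\omega^2\right]^2}\,dt\right\},$$ $$|\beta|^2\le\sinh^2\left\{\frac12\int_{t_i}^{t_f}\frac{1}{|\Omega|}\sqrt{\dot\Omega^2+\left[\Omega^2-\omega^2\right]^2}\,dt\right\}.$$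
   Context: The Bogoliubov coefficients $\alpha,\beta\in\mathbb{C}$ are defined by: the solution of $\ddot\phi(t)+\omega^2(t)\phi(t)=0$ equal to $e^{i\omega_0t}$ for $t\le t_i$ equals $\alpha e^{i\omega_0t}+\beta e^{-i\omega_0t}$ for $t\ge t_f$. The function $\omega^2(t)$ is real but is not required to be positive. Dots denote $d/dt$. *)

theory Defs
  imports "HOL-Analysis.Analysis"
begin

text \<open>The argument \<open>w\<close> stands for the real function written as the square of \<open>\<omega>\<close>; it may be negative.\<close>

definition solves_oscillator :: "(real \<Rightarrow> real) \<Rightarrow> (real \<Rightarrow> complex) \<Rightarrow> bool" where
  "solves_oscillator w \<phi> \<longleftrightarrow>
     (\<exists>\<phi>' \<phi>''. \<forall>t. (\<phi> has_vector_derivative \<phi>' t) (at t) \<and>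
                 (\<phi>' has_vector_derivative \<phi>'' t) (at t) \<and>
                 \<phi>'' t + complex_of_real (w t) * \<phi> t = 0)"

text \<open>For continuous \<open>w\<close> that equals the square of \<open>\<omega>\<^sub>0 > 0\<close> outside \<open>{ti..tf}\<close>, with \<open>ti \<le> tf\<close>, the
  solution \<open>\<phi>\<close> is unique, and it exists, by the standard theory of linear ODEs; as the two
  exponentials are linearly independent on \<open>{tf..}\<close>, the relation then holds for exactly one
  pair \<open>(\<alpha>, \<beta>)\<close>.\<close>

definition bogoliubov_coefficients ::
    "real \<Rightarrow> (real \<Rightarrow> real) \<Rightarrow> real \<Rightarrow> real \<Rightarrow> complex \<Rightarrow> complex \<Rightarrow> bool" where
  "bogoliubov_coefficients \<omega>\<^sub>0 w ti tf \<alpha> \<beta> \<longleftrightarrow>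
     (\<exists>\<phi>. solves_oscillator w \<phi> \<and>
          (\<forall>t\<le>ti. \<phi> t = exp (\<i> * complex_of_real (\<omega>\<^sub>0 * t))) \<and>
          (\<forall>t\<ge>tf. \<phi> t = \<alpha> * exp (\<i> * complex_of_real (\<omega>\<^sub>0 * t))
                      + \<beta> * exp (- (\<i> * complex_of_real (\<omega>\<^sub>0 * t)))))"

end

(* Write \<phi> = x + i y and let c = x y' - y x' be the conserved Wronskian. The energy
     E = (|\<phi>'|^2 / \<Omega> + \<Omega> |\<phi>|^2) / 2
   satisfies E' = (P (\<Omega>^2 - w) + Q \<Omega>') / \<Omega> with P = x x' + y y',
   Q = (\<Omega> |\<phi>|^2 - |\<phi>'|^2 / \<Omega>) / 2 and P^2 + Q^2 = E^2 - c^2, so by Cauchy-Schwarz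
   E' \<le> \<theta> sqrt (E^2 - c^2), where \<theta> is the integrand of the bounds. Thus arcosh (E / c) grows at
   rate at most \<theta>. At the left end E / c = 1, and at the right end E / c = |\<alpha>|^2 + |\<beta>|^2,
   while conservation of the Wronskian gives |\<alpha>|^2 - |\<beta>|^2 = 1. *)
theory Submission
  imports Defs
begin

text \<open>This is the action variable: the energy of a planar oscillator of frequency
  \<open>\<Omega>\<close>, divided by \<open>\<Omega>\<close>. The arguments are numbers rather than
  functions, so the identity for its square is pure algebra.\<close>

definition oscillator_energy :: "real \<Rightarrow> real \<Rightarrow> real \<Rightarrow> real \<Rightarrow> real \<Rightarrow> real" where
  "oscillator_energy \<Omega> x x' y y' = ((x'\<^sup>2 + y'\<^sup>2) / \<Omega> + \<Omega> * (x\<^sup>2 + y\<^sup>2)) / 2"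

text \<open>By Lagrange's identity the squares of the two sides differ by
  \<open>(p * s - q * r)\<^sup>2\<close>.\<close>

lemma cauchy_schwarz_2:
  fixes p q r s :: real
  shows "p * r + q * s \<le> sqrt (p\<^sup>2 + q\<^sup>2) * sqrt (r\<^sup>2 + s\<^sup>2)"
proof -
  have "(p * r + q * s)\<^sup>2 \<le> (p\<^sup>2 + q\<^sup>2) * (r\<^sup>2 + s\<^sup>2)"
    using zero_le_power2[of "p * s - q * r"] by (simp add: power2_eq_square algebra_simps)
  then show ?thesis
    unfolding real_sqrt_mult[symmetric] by (rule real_le_rsqrt)
qed

text \<open>The energy is the mean of \<open>A\<close> and \<open>B\<close>, so its square is that
  of their half difference plus \<open>A * B\<close>. This product is |\<phi>|^2 |\<phi>'|^2, the
  sum of the squares of the real and imaginary parts of conj(\<phi>) \<phi>'.\<close>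

lemma oscillator_energy_square:
  fixes \<Omega> x x' y y' :: real
  assumes "\<Omega> \<noteq> 0"
  shows "(oscillator_energy \<Omega> x x' y y')\<^sup>2 =
    (x * x' + y * y')\<^sup>2 + ((\<Omega> * (x\<^sup>2 + y\<^sup>2) - (x'\<^sup>2 + y'\<^sup>2) / \<Omega>) / 2)\<^sup>2 + (x * y' - y * x')\<^sup>2"
proof -
  define A where "A = (x'\<^sup>2 + y'\<^sup>2) / \<Omega>"
  define B where "B = \<Omega> * (x\<^sup>2 + y\<^sup>2)"
  have "A * B = (x'\<^sup>2 + y'\<^sup>2) * (x\<^sup>2 + y\<^sup>2)"
    using assms by (simp add: A_def B_def)
  moreover have "(x'\<^sup>2 + y'\<^sup>2) * (x\<^sup>2 + y\<^sup>2) = (x * x' + y * y')\<^sup>2 + (x * y' - y * x')\<^sup>2"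
    by algebra
  moreover have "((A + B) / 2)\<^sup>2 = ((B - A) / 2)\<^sup>2 + A * B"
    by (simp add: power2_eq_square field_simps)
  ultimately show ?thesis
    by (simp add: oscillator_energy_def A_def B_def)
qed

text \<open>The energy would be conserved if \<open>\<Omega>\<close> were constant with square
  \<open>w\<close>, so its derivative is linear in the two defects
  \<open>(\<Omega> t)\<^sup>2 - w t\<close> and \<open>\<Omega>' t\<close>. The grouping as an inner
  product is the one to which \<open>cauchy_schwarz_2\<close> applies.\<close>

lemma oscillator_energy_has_derivative:
  fixes x x1 y y1 \<Omega> \<Omega>' w :: "real \<Rightarrow> real"
  assumes "(x has_real_derivative x1 t) (at t within S)"
    and "(x1 has_real_derivative - w t * x t) (at t within S)"
    and "(y has_real_derivative y1 t) (at t within S)"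
    and "(y1 has_real_derivative - w t * y t) (at t within S)"
    and "(\<Omega> has_real_derivative \<Omega>' t) (at t within S)"
    and "\<Omega> t \<noteq> 0"
  shows "((\<lambda>t. oscillator_energy (\<Omega> t) (x t) (x1 t) (y t) (y1 t)) has_real_derivative
    ((x t * x1 t + y t * y1 t) * ((\<Omega> t)\<^sup>2 - w t) +
     (\<Omega> t * ((x t)\<^sup>2 + (y t)\<^sup>2) - ((x1 t)\<^sup>2 + (y1 t)\<^sup>2) / \<Omega> t) / 2 * \<Omega>' t) / \<Omega> t) (at t within S)"
  unfolding oscillator_energy_def
  by (rule derivative_eq_intros assms refl)+
     (use assms(6) in \<open>simp_all add: power2_eq_square field_simps\<close>)

text \<open>For c > 0 and E \<ge> c, E + sqrt (E^2 - c^2) = c exp (arcosh (E / c)), so this is the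
  growth bound for arcosh (E / c) in exponentiated form, free of division by
  \<open>c\<close>.\<close>

lemma oscillator_energy_growth:
  fixes x x1 y y1 \<Omega> \<Omega>' w :: "real \<Rightarrow> real" and a b c :: real
  defines "\<theta> \<equiv> \<lambda>t. 1 / \<bar>\<Omega> t\<bar> * sqrt ((\<Omega>' t)\<^sup>2 + ((\<Omega> t)\<^sup>2 - w t)\<^sup>2)"
    and "E \<equiv> \<lambda>t. oscillator_energy (\<Omega> t) (x t) (x1 t) (y t) (y1 t)"
  assumes ab: "a \<le> b"
    and x: "\<And>t. t \<in> {a..b} \<Longrightarrow> (x has_real_derivative x1 t) (at t within {a..b})"
    and x1: "\<And>t. t \<in> {a..b} \<Longrightarrow> (x1 has_real_derivative - w t * x t) (at t within {a..b})"
    and y: "\<And>t. t \<in> {a..b} \<Longrightarrow> (y has_real_derivative y1 t) (at t within {a..b})"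
    and y1: "\<And>t. t \<in> {a..b} \<Longrightarrow> (y1 has_real_derivative - w t * y t) (at t within {a..b})"
    and \<Omega>: "\<And>t. t \<in> {a..b} \<Longrightarrow> (\<Omega> has_real_derivative \<Omega>' t) (at t within {a..b})"
    and pos: "\<And>t. t \<in> {a..b} \<Longrightarrow> \<Omega> t > 0"
    and int: "\<theta> integrable_on {a..b}"
    and c: "\<And>t. t \<in> {a..b} \<Longrightarrow> x t * y1 t - y t * x1 t = c"
  shows "E b + sqrt ((E b)\<^sup>2 - c\<^sup>2) \<le> (E a + sqrt ((E a)\<^sup>2 - c\<^sup>2)) * exp (integral {a..b} \<theta>)"
proof -
  (* The square root is not differentiable where E = c, so it is regularised by \<epsilon>. *)
  define S where "S = (\<lambda>\<epsilon> t. sqrt ((E t)\<^sup>2 - c\<^sup>2 + \<epsilon>))"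
  have reg: "E b + S \<epsilon> b \<le> (E a + S \<epsilon> a) * exp (integral {a..b} \<theta>)" if "\<epsilon> > 0" for \<epsilon>
  proof -
    define E' where "E' = (\<lambda>t. ((x t * x1 t + y t * y1 t) * ((\<Omega> t)\<^sup>2 - w t) +
      (\<Omega> t * ((x t)\<^sup>2 + (y t)\<^sup>2) - ((x1 t)\<^sup>2 + (y1 t)\<^sup>2) / \<Omega> t) / 2 * \<Omega>' t) / \<Omega> t)"
    have E: "(E has_real_derivative E' t) (at t within {a..b})" if "t \<in> {a..b}" for t
      unfolding E_def E'_def
      by (rule oscillator_energy_has_derivative) (use that x x1 y y1 \<Omega> pos[of t] in auto)
    have E0: "E t \<ge> 0" if "t \<in> {a..b}" for t
      using pos[OF that] by (simp add: E_def oscillator_energy_def)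
    have sq: "(E t)\<^sup>2 - c\<^sup>2 = (x t * x1 t + y t * y1 t)\<^sup>2 +
        ((\<Omega> t * ((x t)\<^sup>2 + (y t)\<^sup>2) - ((x1 t)\<^sup>2 + (y1 t)\<^sup>2) / \<Omega> t) / 2)\<^sup>2" if "t \<in> {a..b}" for t
      using oscillator_energy_square[of "\<Omega> t" "x t" "x1 t" "y t" "y1 t"] pos[OF that] c[OF that]
      by (simp add: E_def)
    have arg: "(E t)\<^sup>2 - c\<^sup>2 + \<epsilon> > 0" if "t \<in> {a..b}" for t
      unfolding sq[OF that] using \<open>\<epsilon> > 0\<close> by (simp add: add_nonneg_pos)
    have S0: "S \<epsilon> t > 0" if "t \<in> {a..b}" for t
      using arg[OF that] by (simp add: S_def)
    have ES0: "E t + S \<epsilon> t > 0" if "t \<in> {a..b}" for t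
      using E0[OF that] S0[OF that] by simp
    have E'_le: "E' t \<le> \<theta> t * S \<epsilon> t" if "t \<in> {a..b}" for t
    proof -
      have "E' t \<le> sqrt ((E t)\<^sup>2 - c\<^sup>2) * sqrt (((\<Omega> t)\<^sup>2 - w t)\<^sup>2 + (\<Omega>' t)\<^sup>2) / \<Omega> t"
        unfolding E'_def sq[OF that]
        using pos[OF that] by (intro divide_right_mono cauchy_schwarz_2) auto
      also have "\<dots> = \<theta> t * sqrt ((E t)\<^sup>2 - c\<^sup>2)"
        using pos[OF that] by (simp add: \<theta>_def add.commute)
      also have "\<dots> \<le> \<theta> t * S \<epsilon> t"
        unfolding S_def \<theta>_def using \<open>\<epsilon> > 0\<close> by (intro mult_left_mono) auto
      finally show ?thesis .
    qed
    \<comment> \<open>The logarithm takes the place of arcosh (E / c). Since S' = E E' / S, the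
      derivative of E + S is (E + S) E' / S, and the factor E + S cancels.\<close>
    have "((\<lambda>t. ln (E t + S \<epsilon> t)) has_real_derivative E' t / S \<epsilon> t) (at t within {a..b})"
      if "t \<in> {a..b}" for t
    proof -
      have "(S \<epsilon> has_real_derivative E t * E' t / S \<epsilon> t) (at t within {a..b})"
      proof -
        have "((\<lambda>t. (E t)\<^sup>2 - c\<^sup>2 + \<epsilon>) has_real_derivative 2 * E t * E' t) (at t within {a..b})"
          by (rule derivative_eq_intros E that refl)+ simp
        from DERIV_chain2[where f = sqrt, OF DERIV_real_sqrt this] arg[OF that]
        show ?thesis by (simp add: S_def field_simps)
      qed
      then have "((\<lambda>t. ln (E t + S \<epsilon> t)) has_real_derivative
          1 / (E t + S \<epsilon> t) * (E' t + E t * E' t / S \<epsilon> t)) (at t within {a..b})"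
        by (intro DERIV_chain2[OF DERIV_ln_divide] DERIV_add E that ES0)
      moreover have "1 / (E t + S \<epsilon> t) * (E' t + E t * E' t / S \<epsilon> t) = E' t / S \<epsilon> t"
      proof -
        have "E' t + E t * E' t / S \<epsilon> t = (E t + S \<epsilon> t) * (E' t / S \<epsilon> t)"
          using S0[OF that] by (simp add: field_simps)
        then show ?thesis using ES0[OF that] by simp
      qed
      ultimately show ?thesis by simp
    qed
    \<comment> \<open>The gauge integral integrates every derivative, so integrability of the
      integrand comes with the fundamental theorem.\<close>
    then have "((\<lambda>t. E' t / S \<epsilon> t) has_integral ln (E b + S \<epsilon> b) - ln (E a + S \<epsilon> a)) {a..b}"
      by (intro fundamental_theorem_of_calculus ab)
         (simp add: has_real_derivative_iff_has_vector_derivative)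
    moreover have "E' t / S \<epsilon> t \<le> \<theta> t" if "t \<in> {a..b}" for t
      using E'_le[OF that] S0[OF that] by (simp add: field_simps)
    ultimately have "ln (E b + S \<epsilon> b) - ln (E a + S \<epsilon> a) \<le> integral {a..b} \<theta>"
      using has_integral_le integrable_integral[OF int] by blast
    then have "ln (E b + S \<epsilon> b) \<le> ln ((E a + S \<epsilon> a) * exp (integral {a..b} \<theta>))"
      using ES0[of a] ab by (simp add: ln_mult)
    then show ?thesis
      using ES0[of a] ES0[of b] ab by simp
  qed
  have lim: "((\<lambda>\<epsilon>. S \<epsilon> t) \<longlongrightarrow> sqrt ((E t)\<^sup>2 - c\<^sup>2)) (at_right 0)" for t
    unfolding S_def by (auto intro!: tendsto_eq_intros)
  \<comment> \<open>Both sides of \<open>reg\<close> converge as \<epsilon> tends to 0 from the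
    right, and the inequality passes to the limit.\<close>
  show ?thesis
    by (rule tendsto_le[OF _ tendsto_mult_right[OF tendsto_add[OF tendsto_const lim]]
          tendsto_add[OF tendsto_const lim]])
       (use reg in \<open>auto simp: eventually_at_right_less intro: eventually_at_rightI[of 0 1]\<close>)
qed

text \<open>The left side of the second assumption is exp (arcosh u), so arcosh u \<le> z; as arcosh
  u \<ge> 0, monotonicity of cosh on the nonnegative reals applies.\<close>

lemma le_cosh_of_add_sqrt_le_exp:
  fixes u z :: real
  assumes "u \<ge> 1" and "u + sqrt (u\<^sup>2 - 1) \<le> exp z"
  shows "u \<le> cosh z"
proof -
  have "0 < u + sqrt (u\<^sup>2 - 1)"
    using assms(1) by (simp add: add_pos_nonneg)
  then have "arcosh u \<le> z"
    using assms ln_mono[OF assms(2)] by (simp add: arcosh_real_def)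
  moreover have "0 \<le> arcosh u"
    using assms(1) by simp
  ultimately have "cosh (arcosh u) \<le> cosh z"
    using cosh_real_nonneg_le_iff by force
  then show ?thesis using assms(1) by simp
qed

lemma oscillator_wronskian_constant:
  fixes x x1 y y1 w :: "real \<Rightarrow> real"
  assumes "\<And>t. (x has_real_derivative x1 t) (at t)"
    and "\<And>t. (x1 has_real_derivative - w t * x t) (at t)"
    and "\<And>t. (y has_real_derivative y1 t) (at t)"
    and "\<And>t. (y1 has_real_derivative - w t * y t) (at t)"
  shows "x s * y1 s - y s * x1 s = x t * y1 t - y t * x1 t"
proof -
  have "((\<lambda>t. x t * y1 t - y t * x1 t) has_real_derivative 0) (at t)" for t
    by (rule derivative_eq_intros assms refl)+ (simp add: algebra_simps)
  then show ?thesis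
    using DERIV_isconst_all[of "\<lambda>t. x t * y1 t - y t * x1 t" s t] by blast
qed

text \<open>Obtained by restricting an entire function to the real line. The set \<open>T\<close> is
  arbitrary because the derivative is needed on one-sided intervals.\<close>

lemma plane_wave_has_vector_derivative:
  fixes \<alpha> \<beta> :: complex and \<omega> :: real
  shows "((\<lambda>t. \<alpha> * exp (\<i> * complex_of_real (\<omega> * t)) + \<beta> * exp (- (\<i> * complex_of_real (\<omega> * t))))
    has_vector_derivative \<i> * \<omega> * (\<alpha> * exp (\<i> * complex_of_real (\<omega> * t)) -
      \<beta> * exp (- (\<i> * complex_of_real (\<omega> * t))))) (at t within T)"
proof -
  have "((\<lambda>z. \<alpha> * exp (\<i> * (\<omega> * z)) + \<beta> * exp (- (\<i> * (\<omega> * z)))) has_field_derivative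
      \<i> * \<omega> * (\<alpha> * exp (\<i> * (\<omega> * of_real t)) - \<beta> * exp (- (\<i> * (\<omega> * of_real t)))))
      (at (of_real t))"
    by (auto intro!: derivative_eq_intros simp: algebra_simps)
  from has_vector_derivative_real_field[OF this] show ?thesis
    by (simp add: has_vector_derivative_at_within)
qed

text \<open>The parallelogram law gives the energy, and the mixed terms of the Wronskian cancel.
  Applied at \<open>ti\<close> and \<open>tf\<close>, this turns E and c into the Bogoliubov
  coefficients.\<close>

lemma plane_wave_energy:
  fixes u v :: complex and \<omega> :: real
  assumes "\<omega> \<noteq> 0"
  defines "p \<equiv> u + v" and "q \<equiv> \<i> * \<omega> * (u - v)"
  shows "oscillator_energy \<omega> (Re p) (Re q) (Im p) (Im q) = \<omega> * ((cmod u)\<^sup>2 + (cmod v)\<^sup>2)"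
    and "Re p * Im q - Im p * Re q = \<omega> * ((cmod u)\<^sup>2 - (cmod v)\<^sup>2)"
  using assms(1) unfolding oscillator_energy_def p_def q_def cmod_power2
  by (simp_all add: field_simps power2_eq_square)

theorem mainTheorem3:
  fixes \<omega>\<^sub>0 ti tf :: real
    and w :: "real \<Rightarrow> real"
    and \<alpha> \<beta> :: complex
    and \<Omega> \<Omega>' :: "real \<Rightarrow> real"
  assumes "\<omega>\<^sub>0 > 0"
    and "ti \<le> tf"
    and "continuous_on UNIV w"
    and "\<And>t. t \<notin> {ti..tf} \<Longrightarrow> w t = \<omega>\<^sub>0\<^sup>2"
    and "bogoliubov_coefficients \<omega>\<^sub>0 w ti tf \<alpha> \<beta>"
    and "\<And>t. t \<in> {ti..tf} \<Longrightarrow> (\<Omega> has_real_derivative \<Omega>' t) (at t within {ti..tf})"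
    and "continuous_on {ti..tf} \<Omega>'"
    and "\<And>t. t \<in> {ti..tf} \<Longrightarrow> \<Omega> t \<noteq> 0"
    and "\<Omega> ti = \<omega>\<^sub>0" and "\<Omega> tf = \<omega>\<^sub>0"
  shows "(cmod \<alpha>)\<^sup>2 \<le> (cosh (1 / 2 * integral {ti..tf}
            (\<lambda>t. 1 / \<bar>\<Omega> t\<bar> * sqrt ((\<Omega>' t)\<^sup>2 + ((\<Omega> t)\<^sup>2 - w t)\<^sup>2))))\<^sup>2 \<and>
         (cmod \<beta>)\<^sup>2 \<le> (sinh (1 / 2 * integral {ti..tf}
            (\<lambda>t. 1 / \<bar>\<Omega> t\<bar> * sqrt ((\<Omega>' t)\<^sup>2 + ((\<Omega> t)\<^sup>2 - w t)\<^sup>2))))\<^sup>2"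
proof -
  let ?e = "\<lambda>t. exp (\<i> * complex_of_real (\<omega>\<^sub>0 * t))"
  let ?e' = "\<lambda>t. exp (- (\<i> * complex_of_real (\<omega>\<^sub>0 * t)))"
  define \<theta> where "\<theta> = (\<lambda>t. 1 / \<bar>\<Omega> t\<bar> * sqrt ((\<Omega>' t)\<^sup>2 + ((\<Omega> t)\<^sup>2 - w t)\<^sup>2))"
  obtain \<phi> \<phi>' \<phi>'' where
    \<phi>: "\<And>t. (\<phi> has_vector_derivative \<phi>' t) (at t)"
    and \<phi>': "\<And>t. (\<phi>' has_vector_derivative \<phi>'' t) (at t)"
    and ode: "\<And>t. \<phi>'' t + complex_of_real (w t) * \<phi> t = 0"
    and left: "\<And>t. t \<le> ti \<Longrightarrow> \<phi> t = ?e t"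
    and right: "\<And>t. t \<ge> tf \<Longrightarrow> \<phi> t = \<alpha> * ?e t + \<beta> * ?e' t"
    using assms(5) unfolding bogoliubov_coefficients_def solves_oscillator_def by metis
  have ode': "\<phi>'' t = - complex_of_real (w t) * \<phi> t" for t
    using ode[of t] by (simp add: add_eq_0_iff)
  have x: "((\<lambda>t. Re (\<phi> t)) has_real_derivative Re (\<phi>' t)) (at t)" for t
    unfolding has_real_derivative_iff_has_vector_derivative
    by (rule bounded_linear.has_vector_derivative[OF bounded_linear_Re \<phi>])
  have y: "((\<lambda>t. Im (\<phi> t)) has_real_derivative Im (\<phi>' t)) (at t)" for t
    unfolding has_real_derivative_iff_has_vector_derivative
    by (rule bounded_linear.has_vector_derivative[OF bounded_linear_Im \<phi>])
  have x1: "((\<lambda>t. Re (\<phi>' t)) has_real_derivative - w t * Re (\<phi> t)) (at t)" for t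
    using bounded_linear.has_vector_derivative[OF bounded_linear_Re \<phi>'[of t]]
    by (simp add: has_real_derivative_iff_has_vector_derivative ode')
  have y1: "((\<lambda>t. Im (\<phi>' t)) has_real_derivative - w t * Im (\<phi> t)) (at t)" for t
    using bounded_linear.has_vector_derivative[OF bounded_linear_Im \<phi>'[of t]]
    by (simp add: has_real_derivative_iff_has_vector_derivative ode')

  \<comment> \<open>The explicit form of \<phi> is known only up to \<open>ti\<close>, so \<phi>' is
    identified there as a one-sided derivative; at \<open>tf\<close> the same is done from the
    right. The term \<open>- 0\<close> keeps the shape of \<open>plane_wave_energy\<close> with
    \<open>v = 0\<close>.\<close>
  have \<phi>'_ti: "\<phi>' ti = \<i> * \<omega>\<^sub>0 * (?e ti - 0)"
  proof (rule vector_derivative_unique_within_closed_interval)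
    show "ti - 1 < ti" "ti \<in> cbox (ti - 1) ti" by auto
    show "(\<phi> has_vector_derivative \<phi>' ti) (at ti within cbox (ti - 1) ti)"
      by (rule has_vector_derivative_at_within[OF \<phi>])
    show "(\<phi> has_vector_derivative \<i> * \<omega>\<^sub>0 * (?e ti - 0)) (at ti within cbox (ti - 1) ti)"
    proof (rule has_vector_derivative_transform)
      show "(?e has_vector_derivative \<i> * \<omega>\<^sub>0 * (?e ti - 0)) (at ti within cbox (ti - 1) ti)"
        using plane_wave_has_vector_derivative[of 1 \<omega>\<^sub>0 0] by simp
    qed (simp_all add: left)
  qed
  have \<phi>'_tf: "\<phi>' tf = \<i> * \<omega>\<^sub>0 * (\<alpha> * ?e tf - \<beta> * ?e' tf)"
  proof (rule vector_derivative_unique_within_closed_interval)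
    show "tf < tf + 1" "tf \<in> cbox tf (tf + 1)" by auto
    show "(\<phi> has_vector_derivative \<phi>' tf) (at tf within cbox tf (tf + 1))"
      by (rule has_vector_derivative_at_within[OF \<phi>])
    show "(\<phi> has_vector_derivative \<i> * \<omega>\<^sub>0 * (\<alpha> * ?e tf - \<beta> * ?e' tf))
        (at tf within cbox tf (tf + 1))"
      by (rule has_vector_derivative_transform[OF _ _ plane_wave_has_vector_derivative])
         (simp_all only: right cbox_interval atLeastAtMost_iff, simp)
  qed

  define E where "E = (\<lambda>t. oscillator_energy (\<Omega> t) (Re (\<phi> t)) (Re (\<phi>' t)) (Im (\<phi> t)) (Im (\<phi>' t)))"
  define c where "c = (\<lambda>t. Re (\<phi> t) * Im (\<phi>' t) - Im (\<phi> t) * Re (\<phi>' t))"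
  define N where "N = (cmod \<alpha>)\<^sup>2 + (cmod \<beta>)\<^sup>2"
  have E_ti: "E ti = \<omega>\<^sub>0" and c_ti: "c ti = \<omega>\<^sub>0"
    using plane_wave_energy[of \<omega>\<^sub>0 "?e ti" 0] assms(1,9)
    by (simp_all add: E_def c_def left \<phi>'_ti)
  have E_tf: "E tf = \<omega>\<^sub>0 * N" and c_tf: "c tf = \<omega>\<^sub>0 * ((cmod \<alpha>)\<^sup>2 - (cmod \<beta>)\<^sup>2)"
    using plane_wave_energy[of \<omega>\<^sub>0 "\<alpha> * ?e tf" "\<beta> * ?e' tf"] assms(1,10)
    unfolding E_def c_def N_def right[OF order_refl] \<phi>'_tf
    by (simp_all add: norm_mult norm_exp_i_times)
  have c_const: "c t = \<omega>\<^sub>0" for t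
    unfolding c_ti[symmetric] unfolding c_def
    by (rule oscillator_wronskian_constant[OF x x1 y y1])
  have diff: "(cmod \<alpha>)\<^sup>2 - (cmod \<beta>)\<^sup>2 = 1"
    using c_tf c_const[of tf] assms(1) by simp

  have \<Omega>_cont: "continuous_on {ti..tf} \<Omega>"
    using assms(6) by (meson DERIV_continuous continuous_on_eq_continuous_within)
  \<comment> \<open>A continuous function without zeros that starts at
    \<open>\<omega>\<^sub>0 > 0\<close> stays positive, by the intermediate value theorem.\<close>
  have \<Omega>_pos: "\<Omega> t > 0" if t: "t \<in> {ti..tf}" for t
  proof (rule ccontr)
    assume "\<not> \<Omega> t > 0"
    then have "\<exists>s\<ge>ti. s \<le> t \<and> \<Omega> s = 0"
      using t assms(1,9) by (intro IVT2' continuous_on_subset[OF \<Omega>_cont]) auto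
    then show False using assms(8) t by fastforce
  qed
  have \<theta>_int: "\<theta> integrable_on {ti..tf}"
    unfolding \<theta>_def using assms(8)
    by (intro integrable_continuous_interval continuous_intros \<Omega>_cont assms(7)
          continuous_on_subset[OF assms(3)]) auto
  have "E tf + sqrt ((E tf)\<^sup>2 - \<omega>\<^sub>0\<^sup>2) \<le>
      (E ti + sqrt ((E ti)\<^sup>2 - \<omega>\<^sub>0\<^sup>2)) * exp (integral {ti..tf} \<theta>)"
    unfolding E_def \<theta>_def
    using assms(2,6) \<Omega>_pos \<theta>_int[unfolded \<theta>_def] c_const[unfolded c_def] x y x1 y1
    by (intro oscillator_energy_growth) (auto intro: has_field_derivative_at_within)
  moreover have "sqrt ((\<omega>\<^sub>0 * N)\<^sup>2 - \<omega>\<^sub>0\<^sup>2) = \<omega>\<^sub>0 * sqrt (N\<^sup>2 - 1)"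
  proof -
    have "(\<omega>\<^sub>0 * N)\<^sup>2 - \<omega>\<^sub>0\<^sup>2 = \<omega>\<^sub>0\<^sup>2 * (N\<^sup>2 - 1)"
      by (simp add: power_mult_distrib algebra_simps)
    then show ?thesis using assms(1) by (simp add: real_sqrt_mult)
  qed
  \<comment> \<open>At \<open>ti\<close> the energy equals the Wronskian, so the square root on the
    right vanishes.\<close>
  ultimately have "\<omega>\<^sub>0 * (N + sqrt (N\<^sup>2 - 1)) \<le> \<omega>\<^sub>0 * exp (integral {ti..tf} \<theta>)"
    by (simp add: E_ti E_tf distrib_left)
  then have "N + sqrt (N\<^sup>2 - 1) \<le> exp (integral {ti..tf} \<theta>)"
    using assms(1) by simp
  moreover have "N \<ge> 1"
    using diff zero_le_power2[of "cmod \<beta>"] unfolding N_def by linarith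
  ultimately have "N \<le> cosh (2 * (1 / 2 * integral {ti..tf} \<theta>))"
    using le_cosh_of_add_sqrt_le_exp by simp
  \<comment> \<open>The factor 1/2 of the bounds arises here: cosh (2z) equals both 2 cosh^2 z - 1
    and 2 sinh^2 z + 1, while by \<open>diff\<close> N equals both 2 |\<alpha>|^2 - 1 and 2
    |\<beta>|^2 + 1.\<close>
  then have "N \<le> 2 * (cosh (1 / 2 * integral {ti..tf} \<theta>))\<^sup>2 - 1"
    and "N \<le> 2 * (sinh (1 / 2 * integral {ti..tf} \<theta>))\<^sup>2 + 1"
    unfolding cosh_double cosh_square_eq by simp_all
  then show ?thesis
    using diff unfolding N_def \<theta>_def by linarith
qed

end
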